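(* Let $v,w$ be terms of $\overline{\lambda}\mu\tilde{\mu}^*$. (1) If $v\hookrightarrow_r w$ for $r$ one of the rules $\lambda,\mu,\tilde\mu,s_l,s_r$, then $v^{\mathfrak e}\to^+w^{\mathfrak e}$ in $\lambda^{Sym}_{Prop}$. (2) If $v\hookrightarrow_r w$ for $r$ one of the rules $cl_{1,l},cl_{1,r},cl_2$, then $v^{\mathfrak e}\sim w^{\mathfrak e}$.
   Context: $\overline{\lambda}\mu\tilde{\mu}^*$ terms: $p::=\lfloor t,e\rfloor$; $t::=x\mid\lambda x\,t\mid\mu\alpha\,p\mid\overline{e}$; $e::=\alpha\mid(t.e)\mid\tilde{\mu}x\,p\mid\widetilde{t}$ ($x$ $l$-variables, $\alpha$ $r$-variables). $\hookrightarrow_r$ is the compatible closure of rule $r$: ($\lambda$) $\lfloor\lambda x\,t,(t'.e)\rfloor\hookrightarrow\lfloor t',\tilde{\mu}x\lfloor t,e\rfloor\rfloor$; ($\mu$) $\lfloor\mu\alpha\,p,e\rfloor\hookrightarrow p[\alpha:=e]$; ($\tilde\mu$) $\lfloor t,\tilde{\mu}x\,p\rfloor\hookrightarrow p[x:=t]$; ($s_l$) $\mu\alpha\lfloor t,\alpha\rfloor\hookrightarrow t$ if $\alpha\notin Fv(t)$; ($s_r$) $\tilde{\mu}x\lfloor x,e\rfloor\hookrightarrow e$ if $x\notin Fv(e)$; ($cl_{1,l}$) $\overline{\widetilde{t}}\hookrightarrow t$; ($cl_{1,r}$) $\widetilde{\overline{e}}\hookrightarrow e$; ($cl_2$) $\lfloor\overline{e},\widetilde{t}\rfloor\hookrightarrow\lfloor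 t,e\rfloor$. $\lambda^{Sym}_{Prop}$ terms are built from variables by $\langle P_1,P_2\rangle$, $\sigma_i(P)$, $\lambda xP$, $(P_1\star P_2)$; $\to$ is the compatible closure of: $(\lambda xP\star Q)\to P[x:=Q]$; $(Q\star\lambda xP)\to P[x:=Q]$; $\lambda x(P\star x)\to P$ and $\lambda x(x\star P)\to P$ if $x\notin Fv(P)$; $(\langle P_1,P_2\rangle\star\sigma_i(Q))\to(P_i\star Q)$; $(\sigma_i(Q)\star\langle P_1,P_2\rangle)\to(Q\star P_i)$; and the rule $E[P]\to P$ for one-hole contexts $E[-]\neq[-]$ of type $\bot$ with $P$ of type $\bot$ and no free variable of $P$ bound by $E$. $\sim$ is the smallest relation with $x\sim x$; $M\sim M'\Rightarrow\lambda xM\sim\lambda xM',\ \sigma_i(M)\sim\sigma_i(M')$; $M\sim M',N\sim N'\Rightarrow\langle M,N\rangle\sim\langle M',N'\rangle,\ (M\star N)\sim(M'\star N'),\ (M\star N)\sim(N'\star M')$. Translation $\cdot^{\mathfrak e}$: each $r$-variable $\alpha$ has an associated variable $\overline{\alpha}$ of $\lambda^{Sym}_{Prop}$; $\pi_i(y)=\lambda z(y\star\sigma_i(z))$; $\lfloor v,u\rfloor^{\mathfrak e}=(u^{\mathfrak e}\star v^{\mathfrak e})$; $x^{\mathfrak e}=x$; $(\lambda x\,u)^{\mathfrak e}=\lambda y(\lambda x(\pi_2(y)\star u^{\mathfrak e})\star\pi_1(y))$ ($y,z$ fresh); $(\mu\alpha\,p)^{\mathfrak e}=\lambda\overline{\alpha}\,p^{\mathfrak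 e}$; $(\overline{h})^{\mathfrak e}=h^{\mathfrak e}$; $\alpha^{\mathfrak e}=\overline{\alpha}$; $(t.h)^{\mathfrak e}=\langle t^{\mathfrak e},h^{\mathfrak e}\rangle$; $(\tilde\mu x\,p)^{\mathfrak e}=\lambda x\,p^{\mathfrak e}$; $(\widetilde{u})^{\mathfrak e}=u^{\mathfrak e}$. *)

theory Defs
  imports Main
begin

text \<open>
  Terms of both calculi are represented modulo \<open>\<alpha>\<close>-conversion by de Bruijn indices. The first
  calculus has two independent index spaces: \<open>LVar i\<close> counts only the enclosing binders of
  \<open>l\<close>-variables and \<open>RVar i\<close> only those of \<open>r\<close>-variables. Consequently every element of the datatypes
  is a term; indices beyond all binders stand for the free variables.
\<close>

section \<open>The calculus \<open>\<lambda>\<mu>\<mu>~*\<close>\<close>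

datatype cmd = Cut tm cotm
  and tm = LVar nat | Lam tm | Mu cmd | Bar cotm
  and cotm = RVar nat | Dot tm cotm | MuT cmd | Tilde tm

definition upr :: "(nat \<Rightarrow> nat) \<Rightarrow> nat \<Rightarrow> nat" where
  "upr f = case_nat 0 (\<lambda>i. Suc (f i))"

primrec ren_c :: "(nat \<Rightarrow> nat) \<Rightarrow> (nat \<Rightarrow> nat) \<Rightarrow> cmd \<Rightarrow> cmd"
  and ren_t :: "(nat \<Rightarrow> nat) \<Rightarrow> (nat \<Rightarrow> nat) \<Rightarrow> tm \<Rightarrow> tm"
  and ren_e :: "(nat \<Rightarrow> nat) \<Rightarrow> (nat \<Rightarrow> nat) \<Rightarrow> cotm \<Rightarrow> cotm" where
  "ren_c f g (Cut t e) = Cut (ren_t f g t) (ren_e f g e)"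
| "ren_t f g (LVar i) = LVar (f i)"
| "ren_t f g (Lam t) = Lam (ren_t (upr f) g t)"
| "ren_t f g (Mu p) = Mu (ren_c f (upr g) p)"
| "ren_t f g (Bar e) = Bar (ren_e f g e)"
| "ren_e f g (RVar i) = RVar (g i)"
| "ren_e f g (Dot t e) = Dot (ren_t f g t) (ren_e f g e)"
| "ren_e f g (MuT p) = MuT (ren_c (upr f) g p)"
| "ren_e f g (Tilde t) = Tilde (ren_t f g t)"

text \<open>Weakening by one \<open>l\<close>-variable, respectively one \<open>r\<close>-variable.\<close>

abbreviation wkl_t :: "tm \<Rightarrow> tm" where "wkl_t \<equiv> ren_t Suc id"
abbreviation wkr_t :: "tm \<Rightarrow> tm" where "wkr_t \<equiv> ren_t id Suc"
abbreviation wkl_e :: "cotm \<Rightarrow> cotm" where "wkl_e \<equiv> ren_e Suc id"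
abbreviation wkr_e :: "cotm \<Rightarrow> cotm" where "wkr_e \<equiv> ren_e id Suc"

text \<open>Simultaneous capture-avoiding substitution for all \<open>l\<close>- and all \<open>r\<close>-variables.\<close>

primrec sub_c :: "(nat \<Rightarrow> tm) \<Rightarrow> (nat \<Rightarrow> cotm) \<Rightarrow> cmd \<Rightarrow> cmd"
  and sub_t :: "(nat \<Rightarrow> tm) \<Rightarrow> (nat \<Rightarrow> cotm) \<Rightarrow> tm \<Rightarrow> tm"
  and sub_e :: "(nat \<Rightarrow> tm) \<Rightarrow> (nat \<Rightarrow> cotm) \<Rightarrow> cotm \<Rightarrow> cotm" where
  "sub_c s q (Cut t e) = Cut (sub_t s q t) (sub_e s q e)"
| "sub_t s q (LVar i) = s i"
| "sub_t s q (Lam t) = Lam (sub_t (case_nat (LVar 0) (wkl_t \<circ> s)) (wkl_e \<circ> q) t)"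
| "sub_t s q (Mu p) = Mu (sub_c (wkr_t \<circ> s) (case_nat (RVar 0) (wkr_e \<circ> q)) p)"
| "sub_t s q (Bar e) = Bar (sub_e s q e)"
| "sub_e s q (RVar i) = q i"
| "sub_e s q (Dot t e) = Dot (sub_t s q t) (sub_e s q e)"
| "sub_e s q (MuT p) = MuT (sub_c (case_nat (LVar 0) (wkl_t \<circ> s)) (wkl_e \<circ> q) p)"
| "sub_e s q (Tilde t) = Tilde (sub_t s q t)"

text \<open>\<open>p[x := t]\<close> and \<open>p[\<alpha> := e]\<close> for the variable of the binder that has just been removed.\<close>

definition inst_l :: "tm \<Rightarrow> cmd \<Rightarrow> cmd" where
  "inst_l t = sub_c (case_nat t LVar) RVar"

definition inst_r :: "cotm \<Rightarrow> cmd \<Rightarrow> cmd" where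
  "inst_r e = sub_c LVar (case_nat e RVar)"

datatype rule = R_lam | R_mu | R_mut | R_sl | R_sr | R_cl1l | R_cl1r | R_cl2

text \<open>
  In the rules below a subterm that is moved under a binder, or for which the bound variable is
  required not to be free, is a weakened term.
\<close>

inductive contr_c :: "rule \<Rightarrow> cmd \<Rightarrow> cmd \<Rightarrow> bool" where
  "contr_c R_lam (Cut (Lam t) (Dot t' e)) (Cut t' (MuT (Cut t (wkl_e e))))"
| "contr_c R_mu (Cut (Mu p) e) (inst_r e p)"
| "contr_c R_mut (Cut t (MuT p)) (inst_l t p)"
| "contr_c R_cl2 (Cut (Bar e) (Tilde t)) (Cut t e)"

inductive contr_t :: "rule \<Rightarrow> tm \<Rightarrow> tm \<Rightarrow> bool" where
  "contr_t R_sl (Mu (Cut (wkr_t t) (RVar 0))) t"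
| "contr_t R_cl1l (Bar (Tilde t)) t"

inductive contr_e :: "rule \<Rightarrow> cotm \<Rightarrow> cotm \<Rightarrow> bool" where
  "contr_e R_sr (MuT (Cut (LVar 0) (wkl_e e))) e"
| "contr_e R_cl1r (Tilde (Bar e)) e"

inductive red_c :: "rule \<Rightarrow> cmd \<Rightarrow> cmd \<Rightarrow> bool"
  and red_t :: "rule \<Rightarrow> tm \<Rightarrow> tm \<Rightarrow> bool"
  and red_e :: "rule \<Rightarrow> cotm \<Rightarrow> cotm \<Rightarrow> bool"
  for r :: rule where
  "contr_c r p p' \<Longrightarrow> red_c r p p'"
| "contr_t r t t' \<Longrightarrow> red_t r t t'"
| "contr_e r e e' \<Longrightarrow> red_e r e e'"
| "red_t r t t' \<Longrightarrow> red_c r (Cut t e) (Cut t' e)"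
| "red_e r e e' \<Longrightarrow> red_c r (Cut t e) (Cut t e')"
| "red_t r t t' \<Longrightarrow> red_t r (Lam t) (Lam t')"
| "red_c r p p' \<Longrightarrow> red_t r (Mu p) (Mu p')"
| "red_e r e e' \<Longrightarrow> red_t r (Bar e) (Bar e')"
| "red_t r t t' \<Longrightarrow> red_e r (Dot t e) (Dot t' e)"
| "red_e r e e' \<Longrightarrow> red_e r (Dot t e) (Dot t e')"
| "red_c r p p' \<Longrightarrow> red_e r (MuT p) (MuT p')"
| "red_t r t t' \<Longrightarrow> red_e r (Tilde t) (Tilde t')"


section \<open>The calculus \<open>\<lambda>\<^sup>S\<^sup>y\<^sup>m\<^sub>P\<^sub>r\<^sub>o\<^sub>p\<close>\<close>

datatype side = One | Two

primrec pick :: "side \<Rightarrow> 'a \<Rightarrow> 'a \<Rightarrow> 'a" where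
  "pick One a b = a"
| "pick Two a b = b"

datatype sterm =
    SVar nat
  | SPair sterm sterm
  | SInj side sterm
  | SLam sterm
  | Star sterm sterm  (infix "\<star>" 70)

primrec sren :: "(nat \<Rightarrow> nat) \<Rightarrow> sterm \<Rightarrow> sterm" where
  "sren f (SVar i) = SVar (f i)"
| "sren f (SPair P Q) = SPair (sren f P) (sren f Q)"
| "sren f (SInj i P) = SInj i (sren f P)"
| "sren f (SLam P) = SLam (sren (upr f) P)"
| "sren f (P \<star> Q) = (sren f P \<star> sren f Q)"

primrec ssub :: "(nat \<Rightarrow> sterm) \<Rightarrow> sterm \<Rightarrow> sterm" where
  "ssub s (SVar i) = s i"
| "ssub s (SPair P Q) = SPair (ssub s P) (ssub s Q)"
| "ssub s (SInj i P) = SInj i (ssub s P)"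
| "ssub s (SLam P) = SLam (ssub (case_nat (SVar 0) (sren Suc \<circ> s)) P)"
| "ssub s (P \<star> Q) = (ssub s P \<star> ssub s Q)"

definition sinst :: "sterm \<Rightarrow> sterm \<Rightarrow> sterm" where
  "sinst Q = ssub (case_nat Q SVar)"

text \<open>
  Types: the \<open>m\<close>-types are built from atoms and negated atoms by conjunction and disjunction, with
  negation as an involutive operation; \<open>\<bottom>\<close> is a type but not an \<open>m\<close>-type. Variables, and hence the
  entries of a typing environment, have \<open>m\<close>-types.
\<close>

datatype mtype = Atom nat | NAtom nat | And mtype mtype | Or mtype mtype

primrec neg :: "mtype \<Rightarrow> mtype" where
  "neg (Atom a) = NAtom a"
| "neg (NAtom a) = Atom a"
| "neg (And A B) = Or (neg A) (neg B)"
| "neg (Or A B) = And (neg A) (neg B)"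

datatype stype = MType mtype | Bot

inductive typing :: "(nat \<Rightarrow> mtype) \<Rightarrow> sterm \<Rightarrow> stype \<Rightarrow> bool" where
  "typing \<Gamma> (SVar i) (MType (\<Gamma> i))"
| "typing \<Gamma> P (MType A) \<Longrightarrow> typing \<Gamma> Q (MType B) \<Longrightarrow> typing \<Gamma> (SPair P Q) (MType (And A B))"
| "typing \<Gamma> P (MType (pick i A B)) \<Longrightarrow> typing \<Gamma> (SInj i P) (MType (Or A B))"
| "typing (case_nat A \<Gamma>) P Bot \<Longrightarrow> typing \<Gamma> (SLam P) (MType (neg A))"
| "typing \<Gamma> P (MType (neg A)) \<Longrightarrow> typing \<Gamma> Q (MType A) \<Longrightarrow> typing \<Gamma> (P \<star> Q) Bot"

datatype sctx =
    Hole
  | CPairL sctx sterm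
  | CPairR sterm sctx
  | CInj side sctx
  | CLam sctx
  | CStarL sctx sterm
  | CStarR sterm sctx

text \<open>Filling the hole may capture: the \<open>depth E\<close> lowest indices of \<open>P\<close> are bound in \<open>plug E P\<close>.\<close>

primrec plug :: "sctx \<Rightarrow> sterm \<Rightarrow> sterm" where
  "plug Hole P = P"
| "plug (CPairL E Q) P = SPair (plug E P) Q"
| "plug (CPairR Q E) P = SPair Q (plug E P)"
| "plug (CInj i E) P = SInj i (plug E P)"
| "plug (CLam E) P = SLam (plug E P)"
| "plug (CStarL E Q) P = (plug E P \<star> Q)"
| "plug (CStarR Q E) P = (Q \<star> plug E P)"

primrec depth :: "sctx \<Rightarrow> nat" where
  "depth Hole = 0"
| "depth (CPairL E Q) = depth E"
| "depth (CPairR Q E) = depth E"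
| "depth (CInj i E) = depth E"
| "depth (CLam E) = Suc (depth E)"
| "depth (CStarL E Q) = depth E"
| "depth (CStarR Q E) = depth E"

text \<open>
  In \<open>triv\<close>, weakening \<open>P\<close> by \<open>depth E\<close> expresses that \<open>E\<close> binds no free variable of \<open>P\<close>. The
  environment \<open>\<Gamma>\<close> is existentially quantified; since a typable term has type \<open>\<bottom>\<close> iff it is of the
  form \<open>P \<star> Q\<close>, on typable terms the choice of \<open>\<Gamma>\<close> does not matter.
\<close>

inductive scontr :: "sterm \<Rightarrow> sterm \<Rightarrow> bool" where
  beta: "scontr (SLam P \<star> Q) (sinst Q P)"
| beta': "scontr (Q \<star> SLam P) (sinst Q P)"
| eta: "scontr (SLam (sren Suc P \<star> SVar 0)) P"
| eta': "scontr (SLam (SVar 0 \<star> sren Suc P)) P"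
| pi: "scontr (SPair P1 P2 \<star> SInj i Q) (pick i P1 P2 \<star> Q)"
| pi': "scontr (SInj i Q \<star> SPair P1 P2) (Q \<star> pick i P1 P2)"
| triv: "E \<noteq> Hole \<Longrightarrow> M = plug E (sren (\<lambda>i. i + depth E) P) \<Longrightarrow>
    typing \<Gamma> M Bot \<Longrightarrow> typing \<Gamma> P Bot \<Longrightarrow> scontr M P"

inductive sred :: "sterm \<Rightarrow> sterm \<Rightarrow> bool" where
  "scontr P Q \<Longrightarrow> sred (plug E P) (plug E Q)"

inductive sim :: "sterm \<Rightarrow> sterm \<Rightarrow> bool" where
  "sim (SVar i) (SVar i)"
| "sim M M' \<Longrightarrow> sim (SLam M) (SLam M')"
| "sim M M' \<Longrightarrow> sim (SInj i M) (SInj i M')"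
| "sim M M' \<Longrightarrow> sim N N' \<Longrightarrow> sim (SPair M N) (SPair M' N')"
| "sim M M' \<Longrightarrow> sim N N' \<Longrightarrow> sim (M \<star> N) (M' \<star> N')"
| "sim M M' \<Longrightarrow> sim N N' \<Longrightarrow> sim (M \<star> N) (N' \<star> M')"


section \<open>The translation\<close>

definition proj :: "side \<Rightarrow> nat \<Rightarrow> sterm" where
  "proj i y = SLam (SVar (Suc y) \<star> SInj i (SVar 0))"

text \<open>
  As the target has a single index space, the translation carries the maps \<open>f\<close> and \<open>g\<close> that give
  the target variables of the \<open>l\<close>- and the \<open>r\<close>-variables (\<open>x\<close> itself and the associated variable of
  \<open>\<alpha>\<close>). Entering a binder of either sort shifts both maps in the target; the bound variable itself
  gets index 0. In the clause for \<open>Lam\<close> the body is below the binders of \<open>y\<close> (index 1) and \<open>x\<close>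
  (index 0).
\<close>

primrec tr_c :: "(nat \<Rightarrow> nat) \<Rightarrow> (nat \<Rightarrow> nat) \<Rightarrow> cmd \<Rightarrow> sterm"
  and tr_t :: "(nat \<Rightarrow> nat) \<Rightarrow> (nat \<Rightarrow> nat) \<Rightarrow> tm \<Rightarrow> sterm"
  and tr_e :: "(nat \<Rightarrow> nat) \<Rightarrow> (nat \<Rightarrow> nat) \<Rightarrow> cotm \<Rightarrow> sterm" where
  "tr_c f g (Cut t e) = (tr_e f g e \<star> tr_t f g t)"
| "tr_t f g (LVar i) = SVar (f i)"
| "tr_t f g (Lam t) =
    SLam (SLam (proj Two 1 \<star> tr_t (upr (Suc \<circ> f)) (Suc \<circ> Suc \<circ> g) t) \<star> proj One 0)"
| "tr_t f g (Mu p) = SLam (tr_c (Suc \<circ> f) (upr g) p)"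
| "tr_t f g (Bar e) = tr_e f g e"
| "tr_e f g (RVar i) = SVar (g i)"
| "tr_e f g (Dot t e) = SPair (tr_t f g t) (tr_e f g e)"
| "tr_e f g (MuT p) = SLam (tr_c (upr f) (Suc \<circ> g) p)"
| "tr_e f g (Tilde t) = tr_t f g t"

end

theory Submission
  imports Defs
begin

text \<open>
  The translation commutes with renaming and substitution, so \<open>\<mu>\<close> and \<open>\<mu>~\<close> become the two
  \<open>\<beta>\<close>-rules, and \<open>s\<^sub>l\<close> and \<open>s\<^sub>r\<close> the two \<open>\<eta>\<close>-rules. For \<open>\<lambda>\<close>, one \<open>\<beta>\<close>-step puts the pair
  \<open>\<langle>t', e\<rangle>\<close> into both projections, and each \<open>\<lambda>z(\<langle>t', e\<rangle> \<star> \<sigma>\<^sub>i(z))\<close> reduces to its component by a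
  pair step followed by an \<open>\<eta>\<close>-step. The translation erases the bar and the tilde, so \<open>cl\<^sub>1\<close> becomes
  an identity and \<open>cl\<^sub>2\<close> swaps the two sides of \<open>\<star>\<close>.
\<close>

section \<open>Renaming and substitution under the translation\<close>

lemma upr_simps [simp]:
  "upr f 0 = 0"
  "upr f (Suc i) = Suc (f i)"
  by (simp_all add: upr_def)

lemma upr_upr: "(\<lambda>i. upr f (upr g i)) = upr (\<lambda>i. f (g i))"
  by (rule ext) (simp add: upr_def split: nat.split)

text \<open>Source renamings precompose the index maps; target renamings, in \<open>sren_tr\<close>,
  postcompose them. Together they match up the weakenings when a substitution passes a
  binder.\<close>

lemma tr_ren:
  "tr_c f g (ren_c a b p) = tr_c (f \<circ> a) (g \<circ> b) p"
  "tr_t f g (ren_t a b t) = tr_t (f \<circ> a) (g \<circ> b) t"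
  "tr_e f g (ren_e a b e) = tr_e (f \<circ> a) (g \<circ> b) e"
  by (induction p and t and e arbitrary: f g a b and f g a b and f g a b)
    (simp_all add: comp_def upr_upr)

lemma sren_tr:
  "sren h (tr_c f g p) = tr_c (h \<circ> f) (h \<circ> g) p"
  "sren h (tr_t f g t) = tr_t (h \<circ> f) (h \<circ> g) t"
  "sren h (tr_e f g e) = tr_e (h \<circ> f) (h \<circ> g) e"
  by (induction p and t and e arbitrary: f g h and f g h and f g h)
    (simp_all add: comp_def upr_upr proj_def)

text \<open>One target substitution serves both sorts of variables, so it only has to agree with
  \<open>s\<close> and \<open>q\<close> along \<open>f'\<close> and \<open>g'\<close>. Its values
  outside the two ranges stay free.\<close>

lemma tr_sub:
  "\<lbrakk>\<And>i. \<sigma> (f' i) = tr_t f g (s i); \<And>i. \<sigma> (g' i) = tr_e f g (q i)\<rbrakk> \<Longrightarrow>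
    ssub \<sigma> (tr_c f' g' p) = tr_c f g (sub_c s q p)"
  "\<lbrakk>\<And>i. \<sigma> (f' i) = tr_t f g (s i); \<And>i. \<sigma> (g' i) = tr_e f g (q i)\<rbrakk> \<Longrightarrow>
    ssub \<sigma> (tr_t f' g' t) = tr_t f g (sub_t s q t)"
  "\<lbrakk>\<And>i. \<sigma> (f' i) = tr_t f g (s i); \<And>i. \<sigma> (g' i) = tr_e f g (q i)\<rbrakk> \<Longrightarrow>
    ssub \<sigma> (tr_e f' g' e) = tr_e f g (sub_e s q e)"
proof (induction p and t and e arbitrary: \<sigma> f g f' g' s q and \<sigma> f g f' g' s q and \<sigma> f g f' g' s q)
  case (Lam t)
  \<comment> \<open>The target has two binders here, the source one. Index 1, the extra
    \<open>y\<close>, lies outside the ranges of the shifted maps, so \<open>s\<close> and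
    \<open>q\<close> are lifted only once.\<close>
  let ?\<sigma> = "case_nat (SVar 0) (sren Suc \<circ> case_nat (SVar 0) (sren Suc \<circ> \<sigma>))"
  have "ssub ?\<sigma> (tr_t (upr (Suc \<circ> f')) (Suc \<circ> Suc \<circ> g') t) =
      tr_t (upr (Suc \<circ> f)) (Suc \<circ> Suc \<circ> g)
        (sub_t (case_nat (LVar 0) (wkl_t \<circ> s)) (wkl_e \<circ> q) t)"
    by (rule Lam.IH)
      (simp_all add: Lam.prems tr_ren sren_tr comp_def upr_def split: nat.split)
  then show ?case
    by (simp add: proj_def)
next
  case (Mu p)
  have "ssub (case_nat (SVar 0) (sren Suc \<circ> \<sigma>)) (tr_c (Suc \<circ> f') (upr g') p) =
      tr_c (Suc \<circ> f) (upr g) (sub_c (wkr_t \<circ> s) (case_nat (RVar 0) (wkr_e \<circ> q)) p)"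
    by (rule Mu.IH)
      (simp_all add: Mu.prems tr_ren sren_tr comp_def upr_def split: nat.split)
  then show ?case
    by simp
next
  case (MuT p)
  have "ssub (case_nat (SVar 0) (sren Suc \<circ> \<sigma>)) (tr_c (upr f') (Suc \<circ> g') p) =
      tr_c (upr f) (Suc \<circ> g) (sub_c (case_nat (LVar 0) (wkl_t \<circ> s)) (wkl_e \<circ> q) p)"
    by (rule MuT.IH)
      (simp_all add: MuT.prems tr_ren sren_tr comp_def upr_def split: nat.split)
  then show ?case
    by simp
qed simp_all

lemma case_nat_var_Suc:
  "case_nat (LVar 0) (wkl_t \<circ> LVar) = LVar"
  "case_nat (RVar 0) (wkr_e \<circ> RVar) = RVar"
  "wkl_e \<circ> RVar = RVar"
  "wkr_t \<circ> LVar = LVar"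
  by (auto simp: fun_eq_iff split: nat.split)

lemma sub_var [simp]:
  "sub_c LVar RVar p = p"
  "sub_t LVar RVar t = t"
  "sub_e LVar RVar e = e"
  by (induction p and t and e) (simp_all add: case_nat_var_Suc)

lemma sinst_tr_l: "sinst (tr_t f g t) (tr_c (upr f) (Suc \<circ> g) p) = tr_c f g (inst_l t p)"
  unfolding sinst_def inst_l_def by (rule tr_sub) (simp_all add: upr_def split: nat.split)

lemma sinst_tr_r: "sinst (tr_e f g e) (tr_c (Suc \<circ> f) (upr g) p) = tr_c f g (inst_r e p)"
  unfolding sinst_def inst_r_def by (rule tr_sub) (simp_all add: upr_def split: nat.split)


section \<open>Compatibility of the target relations\<close>

text \<open>As \<open>sred\<close> is one contraction inside one context, its closure under contexts
  amounts to composing contexts.\<close>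

primrec ctx_comp :: "sctx \<Rightarrow> sctx \<Rightarrow> sctx" where
  "ctx_comp Hole F = F"
| "ctx_comp (CPairL E Q) F = CPairL (ctx_comp E F) Q"
| "ctx_comp (CPairR Q E) F = CPairR Q (ctx_comp E F)"
| "ctx_comp (CInj i E) F = CInj i (ctx_comp E F)"
| "ctx_comp (CLam E) F = CLam (ctx_comp E F)"
| "ctx_comp (CStarL E Q) F = CStarL (ctx_comp E F) Q"
| "ctx_comp (CStarR Q E) F = CStarR Q (ctx_comp E F)"

lemma plug_ctx_comp: "plug (ctx_comp E F) P = plug E (plug F P)"
  by (induction E) simp_all

lemma sred_plug: "sred P Q \<Longrightarrow> sred (plug E P) (plug E Q)"
  by (auto elim!: sred.cases simp: plug_ctx_comp [symmetric] intro: sred.intros)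

lemma sred_trancl_plug: "sred\<^sup>+\<^sup>+ P Q \<Longrightarrow> sred\<^sup>+\<^sup>+ (plug E P) (plug E Q)"
  by (induction rule: tranclp_induct) (auto intro: sred_plug tranclp.trancl_into_trancl)

text \<open>These cover the positions of translated subterms; the translation itself creates
  injections only in \<open>proj\<close>, around a variable.\<close>

lemmas sred_trancl_cong =
  sred_trancl_plug [of _ _ "CPairL Hole R" for R, simplified]
  sred_trancl_plug [of _ _ "CPairR R Hole" for R, simplified]
  sred_trancl_plug [of _ _ "CLam Hole", simplified]
  sred_trancl_plug [of _ _ "CStarL Hole R" for R, simplified]
  sred_trancl_plug [of _ _ "CStarR R Hole" for R, simplified]

lemma scontr_imp_sred: "scontr P Q \<Longrightarrow> sred P Q"
  using sred.intros [of P Q Hole] by simp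

lemma scontr_imp_trancl: "scontr P Q \<Longrightarrow> sred\<^sup>+\<^sup>+ P Q"
  by (intro tranclp.r_into_trancl scontr_imp_sred)

lemma sim_refl: "sim P P"
  by (induction P) (auto intro: sim.intros)

lemma sim_star_commute: "sim (P \<star> Q) (Q \<star> P)"
  by (intro sim.intros(6) sim_refl)


section \<open>Simulation\<close>

text \<open>This is \<open>proj i\<close> with a pair put for its variable; the weakening past the
  binder also supplies the freshness for the final \<eta>-step.\<close>

lemma proj_pair_reduces:
  "sred\<^sup>+\<^sup>+ (SLam (SPair (sren Suc P1) (sren Suc P2) \<star> SInj i (SVar 0))) (pick i P1 P2)"
proof -
  have "scontr (SPair (sren Suc P1) (sren Suc P2) \<star> SInj i (SVar 0))
      (sren Suc (pick i P1 P2) \<star> SVar 0)"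
    by (cases i) (simp_all, (metis scontr.pi pick.simps)+)
  then have "sred\<^sup>+\<^sup>+ (SLam (SPair (sren Suc P1) (sren Suc P2) \<star> SInj i (SVar 0)))
      (SLam (sren Suc (pick i P1 P2) \<star> SVar 0))"
    by (intro sred_trancl_cong scontr_imp_trancl)
  also have "sred\<^sup>+\<^sup>+ \<dots> (pick i P1 P2)"
    by (intro scontr_imp_trancl scontr.eta)
  finally show ?thesis .
qed

lemma tr_lam_step:
  "sred\<^sup>+\<^sup>+ (tr_c f g (Cut (Lam t) (Dot t' e))) (tr_c f g (Cut t' (MuT (Cut t (wkl_e e)))))"
proof -
  define T where "T = tr_t f g t'"
  define R where "R = tr_e f g e"
  let ?B = "tr_t (upr f) (Suc \<circ> g) t"
  \<comment> \<open>The variable \<open>y\<close> (index 1) does not occur in the translated body,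
    so this is \<open>tr_sub\<close> with the identity substitution on the source.\<close>
  have body: "ssub (case_nat (SVar 0) (sren Suc \<circ> case_nat (SPair T R) SVar))
      (tr_t (upr (Suc \<circ> f)) (Suc \<circ> Suc \<circ> g) t) = ?B"
    using tr_sub(2) [where s = LVar and q = RVar and f = "upr f" and g = "Suc \<circ> g" and t = t
        and f' = "upr (Suc \<circ> f)" and g' = "Suc \<circ> Suc \<circ> g"
        and \<sigma> = "case_nat (SVar 0) (sren Suc \<circ> case_nat (SPair T R) SVar)"]
    by (simp add: upr_def split: nat.split)
  \<comment> \<open>The second projection also lies below the binder of \<open>x\<close>, hence its
    additional weakening.\<close>
  have "scontr (tr_c f g (Cut (Lam t) (Dot t' e)))
      (SLam (SLam (SPair (sren Suc (sren Suc T)) (sren Suc (sren Suc R)) \<star> SInj Two (SVar 0)) \<star> ?B) \<star>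
       SLam (SPair (sren Suc T) (sren Suc R) \<star> SInj One (SVar 0)))"
    using scontr.beta' [of "SPair T R"
        "SLam (proj Two 1 \<star> tr_t (upr (Suc \<circ> f)) (Suc \<circ> Suc \<circ> g) t) \<star> proj One 0"]
    by (simp add: sinst_def proj_def body T_def [symmetric] R_def [symmetric])
  moreover have "sred\<^sup>+\<^sup>+
      (SLam (SLam (SPair (sren Suc (sren Suc T)) (sren Suc (sren Suc R)) \<star> SInj Two (SVar 0)) \<star> ?B) \<star>
       SLam (SPair (sren Suc T) (sren Suc R) \<star> SInj One (SVar 0)))
      (SLam (sren Suc R \<star> ?B) \<star> SLam (SPair (sren Suc T) (sren Suc R) \<star> SInj One (SVar 0)))"
    by (intro sred_trancl_cong proj_pair_reduces [where i = Two, simplified])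
  moreover have "sred\<^sup>+\<^sup>+
      (SLam (sren Suc R \<star> ?B) \<star> SLam (SPair (sren Suc T) (sren Suc R) \<star> SInj One (SVar 0)))
      (SLam (sren Suc R \<star> ?B) \<star> T)"
    by (rule sred_trancl_cong(5) [OF proj_pair_reduces [where i = One, simplified]])
  moreover have "SLam (sren Suc R \<star> ?B) \<star> T = tr_c f g (Cut t' (MuT (Cut t (wkl_e e))))"
    by (simp add: T_def R_def tr_ren sren_tr comp_def)
  ultimately show ?thesis
    by (metis scontr_imp_trancl tranclp_trans)
qed

text \<open>A cut is translated with its coterm on the left, so redexes built with \<open>Mu\<close>
  use \<open>beta'\<close> and \<open>eta'\<close>, those with \<open>MuT\<close> use
  \<open>beta\<close> and \<open>eta\<close>.\<close>

lemma contr_tr_sred: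
  assumes "r \<in> {R_lam, R_mu, R_mut, R_sl, R_sr}"
  shows "contr_c r p p' \<Longrightarrow> sred\<^sup>+\<^sup>+ (tr_c f g p) (tr_c f g p')"
    and "contr_t r t t' \<Longrightarrow> sred\<^sup>+\<^sup>+ (tr_t f g t) (tr_t f g t')"
    and "contr_e r e e' \<Longrightarrow> sred\<^sup>+\<^sup>+ (tr_e f g e) (tr_e f g e')"
proof -
  show "sred\<^sup>+\<^sup>+ (tr_c f g p) (tr_c f g p')" if "contr_c r p p'"
    using that
  proof cases
    case 1
    then show ?thesis
      using tr_lam_step by simp
  next
    case (2 p e)
    then show ?thesis
      using scontr.beta' [of "tr_e f g e" "tr_c (Suc \<circ> f) (upr g) p"]
      by (simp add: sinst_tr_r scontr_imp_trancl)
  next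
    case (3 t p)
    then show ?thesis
      using scontr.beta [of "tr_c (upr f) (Suc \<circ> g) p" "tr_t f g t"]
      by (simp add: sinst_tr_l scontr_imp_trancl)
  qed (use assms in simp)
  show "sred\<^sup>+\<^sup>+ (tr_t f g t) (tr_t f g t')" if "contr_t r t t'"
    using that
  proof cases
    case 1
    then show ?thesis
      using scontr.eta' [of "tr_t f g t'"]
      by (simp add: tr_ren sren_tr comp_def scontr_imp_trancl)
  qed (use assms in simp)
  show "sred\<^sup>+\<^sup>+ (tr_e f g e) (tr_e f g e')" if "contr_e r e e'"
    using that
  proof cases
    case 1
    then show ?thesis
      using scontr.eta [of "tr_e f g e'"]
      by (simp add: tr_ren sren_tr comp_def scontr_imp_trancl)
  qed (use assms in simp)
qed

text \<open>The index maps are generalised in the induction because every binder shifts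
  them.\<close>

lemma red_tr_sred:
  assumes "r \<in> {R_lam, R_mu, R_mut, R_sl, R_sr}"
  shows "red_c r p p' \<Longrightarrow> sred\<^sup>+\<^sup>+ (tr_c f g p) (tr_c f g p')"
    and "red_t r t t' \<Longrightarrow> sred\<^sup>+\<^sup>+ (tr_t f g t) (tr_t f g t')"
    and "red_e r e e' \<Longrightarrow> sred\<^sup>+\<^sup>+ (tr_e f g e) (tr_e f g e')"
  by (induction arbitrary: f g and f g and f g rule: red_c_red_t_red_e.inducts)
    (simp_all add: contr_tr_sred [OF assms] sred_trancl_cong)

lemma contr_tr_sim:
  assumes "r \<in> {R_cl1l, R_cl1r, R_cl2}"
  shows "contr_c r p p' \<Longrightarrow> sim (tr_c f g p) (tr_c f g p')"
    and "contr_t r t t' \<Longrightarrow> sim (tr_t f g t) (tr_t f g t')"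
    and "contr_e r e e' \<Longrightarrow> sim (tr_e f g e) (tr_e f g e')"
  using assms
  by (auto elim!: contr_c.cases contr_t.cases contr_e.cases intro: sim_refl sim_star_commute)

lemma red_tr_sim:
  assumes "r \<in> {R_cl1l, R_cl1r, R_cl2}"
  shows "red_c r p p' \<Longrightarrow> sim (tr_c f g p) (tr_c f g p')"
    and "red_t r t t' \<Longrightarrow> sim (tr_t f g t) (tr_t f g t')"
    and "red_e r e e' \<Longrightarrow> sim (tr_e f g e) (tr_e f g e')"
  by (induction arbitrary: f g and f g and f g rule: red_c_red_t_red_e.inducts)
    (simp_all add: contr_tr_sim [OF assms] sim_refl sim.intros)

theorem theorem4p6:
  fixes lv rv :: "nat \<Rightarrow> nat"
  assumes "inj lv" and "inj rv" and "range lv \<inter> range rv = {}"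
  shows "(\<forall>r \<in> {R_lam, R_mu, R_mut, R_sl, R_sr}.
            (\<forall>v w. red_c r v w \<longrightarrow> sred\<^sup>+\<^sup>+ (tr_c lv rv v) (tr_c lv rv w)) \<and>
            (\<forall>v w. red_t r v w \<longrightarrow> sred\<^sup>+\<^sup>+ (tr_t lv rv v) (tr_t lv rv w)) \<and>
            (\<forall>v w. red_e r v w \<longrightarrow> sred\<^sup>+\<^sup>+ (tr_e lv rv v) (tr_e lv rv w))) \<and>
         (\<forall>r \<in> {R_cl1l, R_cl1r, R_cl2}.
            (\<forall>v w. red_c r v w \<longrightarrow> sim (tr_c lv rv v) (tr_c lv rv w)) \<and>
            (\<forall>v w. red_t r v w \<longrightarrow> sim (tr_t lv rv v) (tr_t lv rv w)) \<and>
            (\<forall>v w. red_e r v w \<longrightarrow> sim (tr_e lv rv v) (tr_e lv rv w)))"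
  by (intro conjI ballI allI impI) (fact red_tr_sred red_tr_sim)+

end
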